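(* Fix any positive integers $k\leq n$ and any $k\times n$ matrix $A$ over $\mathbb{F}_2$. There is an NFA $M_A$ over alphabet $[n]$ of size $O(2^k\cdot k\cdot n)$ such that $L_\oplus(M_A)=f_A^{-1}(1)$.
   Context: All sums are in $\mathbb{F}_2$. For non-empty $S\subseteq[k]$ define $\phi_S:(\{0,1\}^k)^k\to\{0,1\}$ by $\phi_S(v_1,\ldots,v_k)=\prod_{i=1}^k\sum_{j\in S}v_{i,j}$, and $\phi=\sum_{\emptyset\neq S\subseteq[k]}\phi_S$. For a $k\times n$ matrix $A$ over $\mathbb{F}_2$ with columns $v_1,\ldots,v_n$, define $f_A:[n]^k\to\{0,1\}$ by $f_A(i_1,\ldots,i_k)=\phi(v_{i_1},\ldots,v_{i_k})$. An NFA is a directed graph of states with labeled transitions, a start state and accepting states; its size is the number of states plus transitions. For an NFA $M$ over $\Sigma$, its XOR-language $L_\oplus(M)\subseteq\Sigma^*$ is the set of words $w$ having an odd number of paths labeled $w$ from the start state to an accepting state. *)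

theory Defs
  imports "Jordan_Normal_Form.Matrix" "HOL-Library.Z2"
begin

text \<open>
  The field with two elements is the library type \<^typ>\<open>bit\<close>. Following the
  convention for matrices and vectors, indices start at 0: the set \<open>[m]\<close> is
  rendered as \<open>{..<m}\<close>. Tuples are lists.
\<close>

definition phi_S :: "nat \<Rightarrow> nat set \<Rightarrow> bit vec list \<Rightarrow> bit" where
  "phi_S k S vs = (\<Prod>i<k. \<Sum>j\<in>S. vs ! i $ j)"

definition phi :: "nat \<Rightarrow> bit vec list \<Rightarrow> bit" where
  "phi k vs = (\<Sum>S\<in>{S. S \<noteq> {} \<and> S \<subseteq> {..<k}}. phi_S k S vs)"

definition tuples :: "nat \<Rightarrow> nat \<Rightarrow> nat list set" where
  "tuples n k = {w. length w = k \<and> set w \<subseteq> {..<n}}"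

text \<open>Only the values on \<open>tuples (dim_col A) (dim_row A)\<close> are meaningful.\<close>

definition f_mat :: "bit mat \<Rightarrow> nat list \<Rightarrow> bit" where
  "f_mat A w = phi (dim_row A) (map (col A) w)"

text \<open>There are no silent transitions: every transition carries a letter.\<close>

record ('q, 'a) nfa =
  alphabet :: "'a set"
  states :: "'q set"
  transitions :: "('q \<times> 'a \<times> 'q) set"
  start :: "'q"
  accepting :: "'q set"

definition is_nfa :: "('q, 'a) nfa \<Rightarrow> bool" where
  "is_nfa M \<longleftrightarrow>
     finite (alphabet M) \<and> finite (states M) \<and>
     transitions M \<subseteq> states M \<times> alphabet M \<times> states M \<and>
     start M \<in> states M \<and> accepting M \<subseteq> states M"

definition nfa_size :: "('q, 'a) nfa \<Rightarrow> nat" where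
  "nfa_size M = card (states M) + card (transitions M)"

text \<open>
  A path is given by its sequence of states. As there is at most one transition
  with a given source, letter and target, the states and the word determine the
  transitions taken.
\<close>

definition accepting_paths :: "('q, 'a) nfa \<Rightarrow> 'a list \<Rightarrow> 'q list set" where
  "accepting_paths M w =
     {qs. length qs = Suc (length w) \<and> set qs \<subseteq> states M \<and>
          hd qs = start M \<and> last qs \<in> accepting M \<and>
          (\<forall>i<length w. (qs ! i, w ! i, qs ! Suc i) \<in> transitions M)}"

definition xor_language :: "('q, 'a) nfa \<Rightarrow> 'a list set" where
  "xor_language M = {w \<in> lists (alphabet M). odd (card (accepting_paths M w))}"

end

theory Submission
  imports Defs "HOL-Library.Nat_Bijection"
begin

text \<open>
  Each product \<open>\<Prod>i. \<Sum>j\<in>S. v\<^sub>i\<^sub>,\<^sub>j\<close> is computed by a chain of \<open>k + 1\<close> states whose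
  transitions carry exactly the letters \<open>a\<close> with \<open>\<Sum>j\<in>S. A\<^sub>j\<^sub>,\<^sub>a = 1\<close>: a word has one
  accepting path in the chain if the product is 1 and none otherwise. Gluing the
  chains of all \<open>S\<close> at a common start state turns the sum over \<open>S\<close> into the
  parity of the number of accepting paths.
\<close>

text \<open>State \<open>i\<close> of chain \<open>c\<close>; all chains share their state 0.\<close>

definition node :: "nat \<Rightarrow> nat \<Rightarrow> nat" where
  "node c i = prod_encode (if i = 0 then 0 else c, i)"

lemma node_0: "node c 0 = node 0 0"
  by (simp add: node_def)

lemma node_eq_iff: "node c i = node d j \<longleftrightarrow> i = j \<and> (i = 0 \<or> c = d)"
  by (auto simp: node_def)

text \<open>Kept generic in the labels \<open>F\<close> and the weights \<open>g\<close>: subsets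
  and column sums enter only when these are instantiated for a matrix.\<close>

definition chain_nfa :: "nat \<Rightarrow> nat \<Rightarrow> nat set \<Rightarrow> (nat \<Rightarrow> nat \<Rightarrow> bit) \<Rightarrow> (nat, nat) nfa" where
  "chain_nfa k n F g = \<lparr>
     alphabet = {..<n},
     states = (\<lambda>(c, i). node c i) ` (F \<times> {..k}),
     transitions = (\<lambda>(c, i, a). (node c i, a, node c (Suc i))) `
       {(c, i, a). c \<in> F \<and> i < k \<and> a < n \<and> g c a = 1},
     start = node 0 0,
     accepting = (\<lambda>c. node c k) ` F\<rparr>"

lemma alphabet_chain_nfa [simp]: "alphabet (chain_nfa k n F g) = {..<n}"
  by (simp add: chain_nfa_def)

lemma transitions_chain_nfa:
  "(p, a, q) \<in> transitions (chain_nfa k n F g) \<longleftrightarrow>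
     (\<exists>c\<in>F. \<exists>i<k. p = node c i \<and> q = node c (Suc i) \<and> a < n \<and> g c a = 1)"
  by (auto simp: chain_nfa_def image_iff)

lemma is_nfa_chain_nfa:
  assumes "finite F" "F \<noteq> {}"
  shows "is_nfa (chain_nfa k n F g)"
proof -
  \<comment> \<open>The start state occurs in \<open>states\<close> only as state 0 of some chain,
    so a label is required.\<close>
  obtain c where "c \<in> F"
    using assms by blast
  then have "node 0 0 \<in> (\<lambda>(c, i). node c i) ` (F \<times> {..k})"
    by (intro image_eqI[where x = "(c, 0)"]) (auto simp: node_def)
  moreover have "node c (Suc i) \<in> (\<lambda>(c, i). node c i) ` (F \<times> {..k})"
    if "c \<in> F" "i < k" for c i
    using that by (intro image_eqI[where x = "(c, Suc i)"]) auto
  ultimately show ?thesis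
    using assms unfolding is_nfa_def chain_nfa_def by force
qed

text \<open>Only a bound: the shared start state is counted once per chain, and letters of weight 0
  are counted as if they had transitions.\<close>

lemma nfa_size_chain_nfa:
  assumes "finite F"
  shows "nfa_size (chain_nfa k n F g) \<le> card F * Suc k + card F * k * n"
proof -
  have "card (states (chain_nfa k n F g)) \<le> card (F \<times> {..k})"
    unfolding chain_nfa_def nfa.simps by (intro card_image_le) (use assms in auto)
  moreover have "card (transitions (chain_nfa k n F g)) \<le> card (F \<times> {..<k} \<times> {..<n})"
  proof -
    have "transitions (chain_nfa k n F g) \<subseteq>
        (\<lambda>(c, i, a). (node c i, a, node c (Suc i))) ` (F \<times> {..<k} \<times> {..<n})"
      unfolding chain_nfa_def nfa.simps by (intro image_mono) auto
    then show ?thesis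
      using assms by (intro surj_card_le) auto
  qed
  ultimately show ?thesis
    by (simp add: nfa_size_def card_cartesian_product)
qed

text \<open>Each transition raises the level by one, so reaching level \<open>k\<close> takes
  exactly \<open>k\<close> letters. Chains meet only at level 0, so a path cannot switch chains and
  its last state determines all of it.\<close>

lemma accepting_paths_chain_nfa:
  assumes "w \<in> lists {..<n}"
  shows "accepting_paths (chain_nfa k n F g) w =
    (if length w = k
     then (\<lambda>c. map (node c) [0..<Suc k]) ` {c \<in> F. \<forall>i<k. g c (w ! i) = 1}
     else {})" (is "?paths = ?R")
proof (intro Set.equalityI subsetI)
  fix qs
  assume "qs \<in> ?paths"
  then have len: "length qs = Suc (length w)"
    and hd: "hd qs = node 0 0"
    and last: "last qs \<in> (\<lambda>c. node c k) ` F"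
    and tr: "\<And>i. i < length w \<Longrightarrow>
      (qs ! i, w ! i, qs ! Suc i) \<in> transitions (chain_nfa k n F g)"
    by (auto simp: accepting_paths_def chain_nfa_def)
  \<comment> \<open>The label may vary with \<open>i\<close> here: the shared start state does not
    reveal which chain is entered.\<close>
  have level: "\<exists>c. qs ! i = node c i" if "i \<le> length w" for i
    using that
  proof (induction i)
    case 0
    show ?case
      using hd len by (metis hd_conv_nth length_0_conv nat.distinct(1))
  next
    case (Suc i)
    then obtain d where "qs ! i = node d i" by auto
    with tr[of i] Suc.prems show ?case
      by (auto simp: transitions_chain_nfa node_eq_iff)
  qed
  have last_nth: "last qs = qs ! length w"
    using len by (metis diff_Suc_1 last_conv_nth length_0_conv nat.distinct(1))
  obtain c where c: "c \<in> F" "qs ! length w = node c k"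
    using last last_nth by auto
  have k: "length w = k"
    using level[of "length w"] c by (auto simp: node_eq_iff)
  \<comment> \<open>Downward from the accepting state: a state at level \<open>Suc i\<close> has a
    unique label, and so fixes the chain of its predecessor.\<close>
  have chain: "qs ! i = node c i" if "i \<le> k" for i
    using that
  proof (induction rule: inc_induct)
    case base
    show ?case using c k by simp
  next
    case (step i)
    then show ?case
      using tr[of i] k
      by (auto simp: transitions_chain_nfa node_eq_iff)
  qed
  have "g c (w ! i) = 1" if "i < k" for i
    using tr[of i] chain[of i] chain[of "Suc i"] that k
    by (auto simp: transitions_chain_nfa node_eq_iff)
  moreover have "qs = map (node c) [0..<Suc k]"
    using chain len k by (intro nth_equalityI) (auto simp del: upt_Suc)
  ultimately show "qs \<in> ?R"
    using c k by auto
next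
  fix qs
  assume "qs \<in> ?R"
  then obtain c where k: "length w = k" and c: "c \<in> F" "\<forall>i<k. g c (w ! i) = 1"
    and qs: "qs = map (node c) [0..<Suc k]"
    by (auto split: if_splits)
  have "w ! i < n" if "i < k" for i
    using assms k that by (auto simp: in_lists_conv_set)
  then have "(qs ! i, w ! i, qs ! Suc i) \<in> transitions (chain_nfa k n F g)" if "i < k" for i
    using c that unfolding qs transitions_chain_nfa
    by (intro bexI[of _ c] exI[of _ i]) (auto simp del: upt_Suc)
  moreover have "hd qs = node 0 0"
    unfolding qs by (simp add: hd_map node_0[of c] del: upt_Suc)
  ultimately show "qs \<in> ?paths"
    using c k unfolding accepting_paths_def
    by (auto simp: chain_nfa_def qs last_map simp del: upt_Suc intro!: image_eqI[where x = "(c, _)"])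
qed

lemma of_nat_bit_eq_1_iff: "of_nat m = (1 :: bit) \<longleftrightarrow> odd m"
  by (induction m) auto

lemma prod_bit_eq:
  fixes h :: "'a \<Rightarrow> bit"
  assumes "finite I"
  shows "(\<Prod>i\<in>I. h i) = of_bool (\<forall>i\<in>I. h i = 1)"
  using assms by (induction I) auto

lemma xor_language_chain_nfa:
  assumes "finite F" "0 < k"
  shows "xor_language (chain_nfa k n F g) =
    {w \<in> tuples n k. (\<Sum>c\<in>F. \<Prod>i<k. g c (w ! i)) = 1}"
proof -
  have "odd (card (accepting_paths (chain_nfa k n F g) w)) \<longleftrightarrow>
      length w = k \<and> (\<Sum>c\<in>F. \<Prod>i<k. g c (w ! i)) = 1"
    if w: "w \<in> lists {..<n}" for w
  proof (cases "length w = k")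
    case True
    \<comment> \<open>Since \<open>k\<close> is positive, paths in different chains differ at level
      1; for \<open>k = 0\<close> they would all be the start state alone.\<close>
    have "inj_on (\<lambda>c. map (node c) [0..<Suc k]) X" for X
      using assms(2) by (auto intro!: inj_onI simp: node_eq_iff)
    then have "card (accepting_paths (chain_nfa k n F g) w) =
        card {c \<in> F. \<forall>i<k. g c (w ! i) = 1}"
      using True by (simp add: accepting_paths_chain_nfa[OF w] card_image del: upt_Suc)
    \<comment> \<open>A product of bits is the indicator of all factors being 1, so the sum over
      \<open>F\<close> counts the accepting chains modulo 2.\<close>
    moreover have "of_nat (card {c \<in> F. \<forall>i<k. g c (w ! i) = 1}) =
        (\<Sum>c\<in>F. \<Prod>i<k. g c (w ! i))"
      using assms(1) by (simp add: prod_bit_eq Ball_def Int_def)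
    ultimately show ?thesis
      using True by (metis of_nat_bit_eq_1_iff)
  qed (simp add: accepting_paths_chain_nfa[OF w])
  then show ?thesis
    by (auto simp: xor_language_def tuples_def in_lists_conv_set)
qed

text \<open>Labels are natural numbers, so subsets are replaced by their codes;
  \<open>set_encode\<close> is injective on finite sets, which permits reindexing the sum.\<close>

lemma f_mat_eq_sum_encode:
  assumes "A \<in> carrier_mat k n" "w \<in> tuples n k"
  shows "f_mat A w =
    (\<Sum>c\<in>set_encode ` {S. S \<noteq> {} \<and> S \<subseteq> {..<k}}. \<Prod>i<k. \<Sum>j\<in>set_decode c. A $$ (j, w ! i))"
proof -
  have fin: "finite S" if "S \<subseteq> {..<k}" for S
    using that finite_subset by blast
  then have "inj_on set_encode {S. S \<noteq> {} \<and> S \<subseteq> {..<k}}"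
    by (auto intro: inj_on_subset[OF inj_on_set_encode])
  moreover have "map (col A) w ! i $ j = A $$ (j, w ! i)" if "i < k" "j < k" for i j
    using assms that by (auto simp: tuples_def subset_iff)
  ultimately show ?thesis
    using assms fin
    by (auto simp: f_mat_def phi_def phi_S_def sum.reindex subset_iff intro!: sum.cong prod.cong)
qed

theorem theorem6p4:
  "\<exists>C::real. \<forall>(k::nat) (n::nat) (A::bit mat).
     0 < k \<and> k \<le> n \<and> A \<in> carrier_mat k n \<longrightarrow>
     (\<exists>M :: (nat, nat) nfa.
        is_nfa M \<and> alphabet M = {..<n} \<and>
        real (nfa_size M) \<le> C * (2 ^ k * real k * real n) \<and>
        xor_language M = {w \<in> tuples n k. f_mat A w = 1})"
proof (intro exI[of _ 3] allI impI)
  fix k n :: nat and A :: "bit mat"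
  assume *: "0 < k \<and> k \<le> n \<and> A \<in> carrier_mat k n"
  define F where "F = set_encode ` {S. S \<noteq> {} \<and> S \<subseteq> {..<k}}"
  define M where "M = chain_nfa k n F (\<lambda>c a. \<Sum>j\<in>set_decode c. A $$ (j, a))"
  have sub: "F \<subseteq> set_encode ` Pow {..<k}"
    by (auto simp: F_def)
  then have fin: "finite F"
    using finite_subset by blast
  have "{..<k} \<noteq> {}"
    using * by auto
  then have "F \<noteq> {}"
    unfolding F_def by blast
  have card: "card F \<le> 2 ^ k"
    using surj_card_le[OF _ sub] by (simp add: card_Pow)
  have "nfa_size M \<le> card F * Suc k + card F * k * n"
    unfolding M_def by (rule nfa_size_chain_nfa[OF fin])
  \<comment> \<open>The constant 3 arises as 2 for the states, from
    \<open>Suc k \<le> 2 * (k * n)\<close>, plus 1 for the transitions.\<close>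
  also have "\<dots> \<le> 2 ^ k * (2 * (k * n)) + 2 ^ k * k * n"
  proof (intro add_mono mult_mono card)
    have "k * 1 \<le> k * n"
      using * by (intro mult_left_mono) auto
    then show "Suc k \<le> 2 * (k * n)"
      using * by linarith
  qed auto
  also have "\<dots> = 3 * (2 ^ k * k * n)"
    by simp
  finally have "real (nfa_size M) \<le> real (3 * (2 ^ k * k * n))"
    by (rule of_nat_mono)
  then have "real (nfa_size M) \<le> 3 * (2 ^ k * real k * real n)"
    by simp
  moreover have "xor_language M = {w \<in> tuples n k. f_mat A w = 1}"
    using * xor_language_chain_nfa[OF fin] f_mat_eq_sum_encode
    unfolding M_def F_def by auto
  moreover have "is_nfa M" "alphabet M = {..<n}"
    using is_nfa_chain_nfa[OF fin \<open>F \<noteq> {}\<close>] by (simp_all add: M_def)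
  ultimately show "\<exists>M :: (nat, nat) nfa. is_nfa M \<and> alphabet M = {..<n} \<and>
      real (nfa_size M) \<le> 3 * (2 ^ k * real k * real n) \<and>
      xor_language M = {w \<in> tuples n k. f_mat A w = 1}"
    by blast
qed

end
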